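(* Let $m$ be the Lebesgue measure on $(\lambda^{-1},1)$, normalized to be a probability measure, and let $m_{\mathfrak X}=\Psi(m)$ be its image on the space $\mathfrak X=\prod_{1}^{\infty}\mathfrak B$ of block sequences under the block expansion map $\Psi$. Then $m_{\mathfrak X}$ is a product measure with equal multipliers, i.e. a Bernoulli measure (under $m$ the successive blocks $B_1(x),B_2(x),\dots$ are independent and identically distributed).
   Context: $\lambda=\frac{1+\sqrt5}{2}$. The canonical expansion of $x\in[0,1)$ is the sequence $(\varepsilon_1\varepsilon_2\dots)$ with $\varepsilon_k=[\lambda T^{k-1}x]$, $Tx=\{\lambda x\}$; then $\varepsilon_k\in\{0,1\}$, $\varepsilon_k\varepsilon_{k+1}=0$, and $x=\sum_{k\ge1}\varepsilon_k\lambda^{-k}$. A block is a finite 0-1 word without two adjacent 1's, starting with 1 and ending with an even (positive) number of zeros, which contains no subword $1(00)^l1$ with $l\ge1$; $\mathfrak B$ is the (countable) set of all blocks. A point $x\in[\lambda^{-1},1)$ is regular if its canonical expansion contains infinitely many subwords $1(00)^l1$, $l\ge1$; Lebesgue-a.e. point of $(\lambda^{-1},1)$ is regular. The canonical expansion of a regular $x$ starts with 1 and splits uniquely as a concatenation $B_1(x)B_2(x)\dots$ of blocks (each block ends as soon as an even positive number of zeros followed by a 1 appears; this 1 begins the next block). The block expansion map is $\Psi(x)=(B_1(x),B_2(x),\dots)\in\mathfrak X$. (The goldenshift $\mathcal S$ on regular points, $\mathcal Sx=T^{|B_1(x)|}x$, corresponds under $\Psi$ to the one-sided shift on $\mathfrak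 X$.) *)

theory Defs
  imports "HOL-Probability.Probability" "HOL-Library.Sublist"
begin

definition golden :: real where
  "golden = (1 + sqrt 5) / 2"

definition golden_map :: "real \<Rightarrow> real" where
  "golden_map x = frac (golden * x)"

(* Digits and blocks are indexed from 0: digit x k is \<epsilon>_(k+1) of the canonical expansion of x. *)
definition digit :: "real \<Rightarrow> nat \<Rightarrow> int" where
  "digit x k = \<lfloor>golden * (golden_map ^^ k) x\<rfloor>"

definition even_gap :: "nat \<Rightarrow> int list" where
  "even_gap l = 1 # replicate (2 * l) 0 @ [1]"

(* The final run of zeros of a block is the maximal one, hence it is preceded by a 1. *)
definition blocks :: "int list set" where
  "blocks = {w. set w \<subseteq> {0, 1} \<and> \<not> sublist [1, 1] w \<and> w \<noteq> [] \<and> hd w = 1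
      \<and> (\<exists>u l. l \<ge> 1 \<and> w = u @ [1] @ replicate (2 * l) 0)
      \<and> (\<forall>l\<ge>1. \<not> sublist (even_gap l) w)}"

definition regular :: "real \<Rightarrow> bool" where
  "regular x \<longleftrightarrow> 1 / golden \<le> x \<and> x < 1
      \<and> infinite {i. \<exists>l\<ge>1. map (digit x) [i..<i + (2 * l + 2)] = even_gap l}"

definition splits_into :: "(nat \<Rightarrow> int) \<Rightarrow> (nat \<Rightarrow> int list) \<Rightarrow> bool" where
  "splits_into e B \<longleftrightarrow> (\<forall>n. B n \<in> blocks)
      \<and> (\<forall>n. let w = concat (map B [0..<n]) in map e [0..<length w] = w)"

(* Meaningful for regular x only, where the splitting exists and is unique. *)
definition block_expansion :: "real \<Rightarrow> nat \<Rightarrow> int list" where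
  "block_expansion x = (THE B. splits_into (digit x) B)"

definition block_space :: "(nat \<Rightarrow> int list) measure" where
  "block_space = (\<Pi>\<^sub>M n\<in>UNIV. count_space blocks)"

definition leb :: "real measure" where
  "leb = uniform_measure lborel {1 / golden<..<1}"

(* The block expansion is defined on regular points, which have full measure under leb. *)
definition leb_regular :: "real measure" where
  "leb_regular = restrict_space leb {x. regular x}"

definition block_measure :: "(nat \<Rightarrow> int list) measure" where
  "block_measure = distr leb_regular block_space block_expansion"

end

(*
  The cylinder of an admissible word w ending in 0 is an affine copy of [0,1) with ratio golden^(-|w|), and the
  |w|-th iterate of the golden map is the affine bijection onto [0,1). For a block b, the points with
  first block b whose goldenshift lies in a set A of regular points are exactly the points of the
  cylinder of b which that iterate sends to A. So this set has measure golden^(-|b|) |A|: the first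
  block is independent of the goldenshift, and the goldenshift preserves the measure. Induction gives
  the product formula for boxes. The weights golden^(-|b|) sum to 1 because almost every point is
  regular.
*)
theory Submission
  imports Defs
begin

section \<open>The golden map and its digits\<close>

text \<open>What has to be overcome is the memory of the digit expansion. After a digit 1 the orbit
  lies in \<open>[0, 1 / golden)\<close>, so for a word ending in 1 the iterate does not fill
  \<open>[0, 1)\<close>; a final 0 removes this restriction. The end of a block could still depend
  on later digits, because a block may be a proper prefix of a longer block. Here the even gap
  decides: regular points start with digit 1, and a block followed by a 1 is not a prefix of any
  longer block. So every block may be followed by every regular point, and this free concatenation
  is the source of independence. For regularity almost everywhere only the shortest gap
  \<open>1001\<close> is considered: the points whose digits avoid it form a forward invariant null
  set, and \<open>golden_map\<close> pulls null sets back to null sets.\<close>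

lemma golden_gt_1: "1 < golden"
  unfolding golden_def by (simp add: real_less_rsqrt)

lemma golden_lt_2: "golden < 2"
proof -
  have "sqrt 5 < 3" by (rule real_less_lsqrt) auto
  then show ?thesis unfolding golden_def by simp
qed

lemma golden_pos: "0 < golden"
  using golden_gt_1 by simp

lemma golden_square: "golden * golden = golden + 1"
  unfolding golden_def by (simp add: field_simps)

lemma one_div_golden: "1 / golden = golden - 1"
  using golden_square golden_pos by (simp add: field_simps)

lemma less_one_div_golden_iff: "x < 1 / golden \<longleftrightarrow> golden * x < 1"
  using golden_pos by (simp add: field_simps)

lemma one_div_golden_le_iff: "1 / golden \<le> x \<longleftrightarrow> 1 \<le> golden * x"
  using golden_pos by (simp add: field_simps)

lemma one_div_golden_le_imp_nonneg: "1 / golden \<le> x \<Longrightarrow> 0 \<le> x"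
  using golden_pos by (rule order_trans[OF less_imp_le[OF zero_less_divide_1_iff[THEN iffD2]]])

lemma golden_map_bounds: "golden_map x \<in> {0..<1}"
  by (simp add: golden_map_def frac_lt_1)

lemma funpow_golden_map_bounds: "x \<in> {0..<1} \<Longrightarrow> (golden_map ^^ n) x \<in> {0..<1}"
  using golden_map_bounds by (cases n) auto

lemma digit_0: "digit x 0 = \<lfloor>golden * x\<rfloor>"
  by (simp add: digit_def)

lemma digit_Suc: "digit x (Suc k) = digit (golden_map x) k"
  by (simp add: digit_def funpow_swap1)

lemma digit_funpow: "digit ((golden_map ^^ k) x) n = digit x (k + n)"
  by (induction k arbitrary: x) (simp_all add: digit_Suc funpow_swap1)

lemma golden_map_low:
  assumes "0 \<le> x" "x < 1 / golden"
  shows "golden_map x = golden * x" "digit x 0 = 0"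
proof -
  have "0 \<le> golden * x" "golden * x < 1"
    using assms golden_pos by (auto simp: less_one_div_golden_iff)
  then have "\<lfloor>golden * x\<rfloor> = 0" by linarith
  then show "golden_map x = golden * x" "digit x 0 = 0"
    by (auto simp: golden_map_def digit_0 frac_def)
qed

lemma golden_map_high:
  assumes "1 / golden \<le> x" "x < 1"
  shows "golden_map x = golden * x - 1" "digit x 0 = 1" "golden_map x < 1 / golden"
proof -
  have 1: "1 \<le> golden * x" using assms by (simp only: one_div_golden_le_iff)
  have 2: "golden * x < golden" using assms golden_pos by simp
  then have "\<lfloor>golden * x\<rfloor> = 1" using 1 golden_lt_2 by linarith
  then show "golden_map x = golden * x - 1" "digit x 0 = 1"
    by (auto simp: golden_map_def digit_0 frac_def)
  then show "golden_map x < 1 / golden" using 2 by (simp add: one_div_golden)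
qed

lemma digit_0_eq_1_iff:
  assumes "x \<in> {0..<1}" shows "digit x 0 = 1 \<longleftrightarrow> 1 / golden \<le> x"
  using assms golden_map_low(2)[of x] golden_map_high(2)[of x] by (cases "x < 1 / golden") auto

lemma digit_in: "x \<in> {0..<1} \<Longrightarrow> digit x k \<in> {0, 1}"
proof -
  assume "x \<in> {0..<1}"
  then have "(golden_map ^^ k) x \<in> {0..<1}" by (rule funpow_golden_map_bounds)
  moreover have "digit x k = digit ((golden_map ^^ k) x) 0" by (simp add: digit_funpow)
  ultimately show ?thesis
    using golden_map_low(2) golden_map_high(2) by (cases "(golden_map ^^ k) x < 1 / golden") auto
qed

lemma digit_no_adjacent_ones:
  assumes "x \<in> {0..<1}" "digit x k = 1" shows "digit x (Suc k) = 0"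
proof -
  let ?y = "(golden_map ^^ k) x"
  have y: "?y \<in> {0..<1}" using assms(1) by (rule funpow_golden_map_bounds)
  have "digit ?y 0 = 1" using assms(2) by (simp add: digit_funpow)
  then have "golden_map ?y < 1 / golden"
    using y golden_map_high(3)[of ?y] digit_0_eq_1_iff by auto
  then have "digit (golden_map ?y) 0 = 0"
    using golden_map_bounds by (intro golden_map_low) auto
  moreover have "digit (golden_map ?y) 0 = digit x (Suc k)"
    using digit_funpow[of "Suc k" x 0] by simp
  ultimately show ?thesis by simp
qed

lemma map_digit_shift:
  "map (digit x) [i + k..<j + k] = map (digit ((golden_map ^^ k) x)) [i..<j]"
  by (rule nth_equalityI) (auto simp: digit_funpow add_ac)

section \<open>Cylinders\<close>

text \<open>The ordinary cylinder is the case \<open>A = {0..<1}\<close>. Carrying a target set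
  \<open>A\<close> keeps the shape when a leading digit is removed, and lets one formula measure the
  word and the event after it together.\<close>

definition cylinder :: "int list \<Rightarrow> real set \<Rightarrow> real set" where
  "cylinder w A = {x \<in> {0..<1}. map (digit x) [0..<length w] = w \<and> (golden_map ^^ length w) x \<in> A}"

lemma mem_cylinder_Cons:
  "x \<in> cylinder (d # w) A \<longleftrightarrow> x \<in> {0..<1} \<and> digit x 0 = d \<and> golden_map x \<in> cylinder w A"
proof -
  have "map (digit x) [0..<length (d # w)] = digit x 0 # map (digit (golden_map x)) [0..<length w]"
    by (simp add: map_upt_Suc digit_Suc del: upt_Suc)
  then show ?thesis
    using golden_map_bounds[of x] by (auto simp: cylinder_def funpow_swap1 simp del: upt_Suc)
qed

lemma cylinder_subset: "cylinder w A \<subseteq> {0..<1}"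
  by (auto simp: cylinder_def)

text \<open>No bounds on \<open>x\<close> appear on the right: \<open>golden * x\<close> in
  \<open>[0, 1)\<close> already forces digit 0. The summand 0 fits the form \<open>t + c * x\<close>
  of \<open>emeasure_affine_vimage\<close>.\<close>

lemma cylinder_zero_Cons: "cylinder (0 # w) A = {x. 0 + golden * x \<in> cylinder w A}"
proof -
  have "x \<in> {0..<1} \<and> digit x 0 = 0 \<and> golden_map x \<in> cylinder w A \<longleftrightarrow> golden * x \<in> cylinder w A" for x
  proof (cases "0 \<le> x \<and> x < 1 / golden")
    case True
    moreover have "1 / golden < 1" using golden_gt_1 by simp
    ultimately show ?thesis using golden_map_low[of x] by auto
  next
    case False
    then have "golden * x \<notin> {0..<1}"
      using golden_pos by (auto simp: less_one_div_golden_iff zero_le_mult_iff)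
    moreover have "\<not> (x \<in> {0..<1} \<and> digit x 0 = 0)"
      using False digit_0_eq_1_iff[of x] by auto
    ultimately show ?thesis using cylinder_subset by blast
  qed
  then show ?thesis
    unfolding set_eq_iff mem_Collect_eq mem_cylinder_Cons add_0 by blast
qed

text \<open>The two digits are removed together because \<open>10\<close> is a full branch: two
  steps of \<open>golden_map\<close> carry \<open>[1 / golden, 1)\<close> affinely onto
  \<open>[0, 1)\<close>, whereas one step reaches only \<open>[0, 1 / golden)\<close>.\<close>

lemma cylinder_one_zero_Cons:
  "cylinder (1 # 0 # w) A = {x. - golden + (golden * golden) * x \<in> cylinder w A}"
proof -
  have eq: "- golden + (golden * golden) * x = golden * (golden * x - 1)" for x
    by (simp add: algebra_simps)
  have "x \<in> {0..<1} \<and> digit x 0 = 1 \<and> golden_map x \<in> cylinder (0 # w) A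
      \<longleftrightarrow> golden * (golden * x - 1) \<in> cylinder w A" for x
  proof (cases "1 / golden \<le> x \<and> x < 1")
    case True
    moreover have "0 \<le> x" using True one_div_golden_le_imp_nonneg by blast
    ultimately show ?thesis
      using golden_map_high[of x] by (auto simp: cylinder_zero_Cons)
  next
    case False
    have "golden * (golden * x - 1) \<notin> {0..<1}"
    proof
      assume *: "golden * (golden * x - 1) \<in> {0..<1}"
      then have "0 \<le> golden * x - 1" using golden_pos by (auto simp: zero_le_mult_iff)
      then have "1 / golden \<le> x" unfolding one_div_golden_le_iff by linarith
      \<comment> \<open>Since \<open>1 / golden = golden - 1\<close>, this bound is the same as
        \<open>x < 1\<close>.\<close>
      moreover have "golden * x - 1 < 1 / golden"
        unfolding less_one_div_golden_iff using * by auto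
      then have "golden * x < golden * 1" unfolding one_div_golden by linarith
      then have "x < 1" unfolding mult_less_cancel_left_pos[OF golden_pos] .
      ultimately show False using False by simp
    qed
    moreover have "\<not> (x \<in> {0..<1} \<and> digit x 0 = 1)"
      using False digit_0_eq_1_iff[of x] by auto
    ultimately show ?thesis using cylinder_subset by blast
  qed
  then show ?thesis
    unfolding set_eq_iff mem_Collect_eq eq mem_cylinder_Cons[of _ 1] by blast
qed

section \<open>Measurability and the measure of cylinders\<close>

lemma golden_map_measurable [measurable]: "golden_map \<in> borel_measurable borel"
  unfolding golden_map_def frac_def by measurable

lemma funpow_golden_map_measurable [measurable]: "(golden_map ^^ n) \<in> borel_measurable borel"
  by (induction n) (simp_all add: comp_def id_def)

lemma digit_measurable [measurable]: "(\<lambda>x. digit x k) \<in> borel \<rightarrow>\<^sub>M count_space UNIV"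
  unfolding digit_def by measurable

lemma map_digit_measurable [measurable]:
  "(\<lambda>x. map (digit x) [i..<j]) \<in> borel \<rightarrow>\<^sub>M count_space UNIV"
proof -
  have "(\<lambda>x. map (digit x) [i..<j]) -` {w} \<inter> space borel
      = {x \<in> space borel. length w = j - i \<and> (\<forall>k<length w. digit x (i + k) = w ! k)}" for w
    by (auto simp: list_eq_iff_nth_eq)
  then show ?thesis unfolding measurable_count_space_eq2_countable by simp
qed

lemma cylinder_measurable [measurable]:
  assumes [measurable]: "A \<in> sets borel"
  shows "cylinder w A \<in> sets borel"
  unfolding cylinder_def by measurable

text \<open>\<open>lborel_real_affine\<close> presents Lebesgue measure as \<open>c\<close> times
  its image under the affine map; evaluate at \<open>A\<close> and divide by
  \<open>c\<close>.\<close>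

lemma emeasure_affine_vimage:
  assumes c: "0 < c" and A: "A \<in> sets borel"
  shows "emeasure lborel {x. t + c * x \<in> A} = ennreal (1 / c) * emeasure lborel A"
proof -
  have "emeasure lborel A = emeasure (density (distr lborel borel (\<lambda>x. t + c * x)) (\<lambda>_. ennreal c)) A"
    using lborel_real_affine[of c t] c by simp
  also have "\<dots> = ennreal c * emeasure (distr lborel borel (\<lambda>x. t + c * x)) A"
    using A by (simp add: emeasure_density nn_integral_cmult_indicator)
  also have "emeasure (distr lborel borel (\<lambda>x. t + c * x)) A = emeasure lborel {x. t + c * x \<in> A}"
    using A by (subst emeasure_distr) (auto simp: vimage_def)
  finally have "ennreal (1 / c) * emeasure lborel A
      = (ennreal (1 / c) * ennreal c) * emeasure lborel {x. t + c * x \<in> A}"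
    by (simp add: mult.assoc)
  also have "ennreal (1 / c) * ennreal c = 1"
    using c by (simp flip: ennreal_mult)
  finally show ?thesis by simp
qed

text \<open>The induction is on length because a leading 1 is removed together with the letter
  behind it. That letter exists since the word ends in 0, and it is 0 since \<open>11\<close> is
  excluded; both properties pass to the remaining word.\<close>

lemma emeasure_cylinder:
  assumes "set w \<subseteq> {0, 1}" "\<not> sublist [1, 1] w" "w = [] \<or> last w = 0"
    and A: "A \<in> sets borel" "A \<subseteq> {0..<1}"
  shows "emeasure lborel (cylinder w A) = ennreal ((1 / golden) ^ length w) * emeasure lborel A"
  using assms(1-3)
proof (induction "length w" arbitrary: w rule: less_induct)
  case less
  have step: "ennreal (1 / golden) * (ennreal ((1 / golden) ^ n) * e) = ennreal ((1 / golden) ^ Suc n) * e" for n e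
    using golden_pos by (simp only: power_Suc) (subst ennreal_mult, auto simp: mult.assoc)
  show ?case
  proof (cases w)
    case Nil
    then have "cylinder w A = A" using A by (auto simp: cylinder_def)
    then show ?thesis using Nil by simp
  next
    case (Cons d v)
    have v: "set v \<subseteq> {0, 1}" "\<not> sublist [1, 1] v" "v = [] \<or> last v = 0"
      using less.prems Cons by (auto simp: sublist_Cons_right split: if_splits)
    show ?thesis
    proof (cases "d = 0")
      case True
      then have "emeasure lborel (cylinder w A) = ennreal (1 / golden) * emeasure lborel (cylinder v A)"
        using Cons A golden_pos by (simp only: cylinder_zero_Cons emeasure_affine_vimage cylinder_measurable)
      also have "emeasure lborel (cylinder v A) = ennreal ((1 / golden) ^ length v) * emeasure lborel A"
        using v Cons by (intro less.hyps) auto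
      finally show ?thesis by (simp only: step Cons list.size) simp
    next
      case False
      then have d: "d = 1" using less.prems Cons by auto
      then obtain c u where u: "v = c # u" using less.prems Cons by (cases v) auto
      have "c \<noteq> 1" using less.prems Cons u d by (auto simp: sublist_Cons_right)
      then have c: "c = 0" using v u by auto
      have *: "set u \<subseteq> {0, 1}" "\<not> sublist [1, 1] u" "u = [] \<or> last u = 0"
        using v u by (auto simp: sublist_Cons_right split: if_splits)
      have "emeasure lborel (cylinder w A)
          = ennreal (1 / (golden * golden)) * emeasure lborel (cylinder u A)"
        using Cons u c d A golden_pos
        by (simp only: cylinder_one_zero_Cons emeasure_affine_vimage cylinder_measurable mult_pos_pos)
      also have "emeasure lborel (cylinder u A) = ennreal ((1 / golden) ^ length u) * emeasure lborel A"
        using * Cons u by (intro less.hyps) auto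
      also have "ennreal (1 / (golden * golden)) = ennreal (1 / golden) * ennreal (1 / golden)"
        using golden_pos by (simp flip: ennreal_mult)
      finally show ?thesis by (simp only: mult.assoc step Cons u list.size) simp
    qed
  qed
qed

section \<open>Almost every point is regular\<close>

text \<open>Lebesgue measure is not invariant under \<open>golden_map\<close>, but null sets pull
  back to null sets: a preimage is covered by the preimages under the two affine branches.\<close>

lemma emeasure_golden_map_vimage_null:
  assumes A: "A \<in> sets borel" "A \<subseteq> {0..<1}" "emeasure lborel A = 0"
  shows "emeasure lborel {x \<in> {0..<1}. (golden_map ^^ n) x \<in> A} = 0"
proof (induction n)
  case 0
  have "{x \<in> {0..<1}. x \<in> A} = A" using A by auto
  then show ?case using A by simp
next
  case (Suc n)
  define B where "B = {x \<in> {0..<1}. (golden_map ^^ n) x \<in> A}"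
  have B[measurable]: "B \<in> sets borel" using A unfolding B_def by measurable
  have "{x \<in> {0..<1}. (golden_map ^^ Suc n) x \<in> A} \<subseteq> {x. 0 + golden * x \<in> B} \<union> {x. -1 + golden * x \<in> B}"
  proof
    fix x assume "x \<in> {x \<in> {0..<1}. (golden_map ^^ Suc n) x \<in> A}"
    then have x: "x \<in> {0..<1}" "golden_map x \<in> B"
      using golden_map_bounds[of x] by (auto simp: B_def funpow_swap1)
    then show "x \<in> {x. 0 + golden * x \<in> B} \<union> {x. -1 + golden * x \<in> B}"
      using golden_map_low(1)[of x] golden_map_high(1)[of x] by (cases "x < 1 / golden") auto
  qed
  then have "emeasure lborel {x \<in> {0..<1}. (golden_map ^^ Suc n) x \<in> A}
      \<le> emeasure lborel {x. 0 + golden * x \<in> B} + emeasure lborel {x. -1 + golden * x \<in> B}"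
    by (intro order_trans[OF emeasure_mono emeasure_subadditive]) measurable
  also have "\<dots> = 0"
    using Suc.IH golden_pos B by (simp only: emeasure_affine_vimage B_def[symmetric]) simp
  finally show ?case by simp
qed

definition no_1001 :: "real set" where
  "no_1001 = {x \<in> {0..<1}. \<forall>i. map (digit x) [i..<i + 4] \<noteq> [1, 0, 0, 1]}"

lemma no_1001_measurable [measurable]: "no_1001 \<in> sets borel"
  unfolding no_1001_def by measurable

lemma golden_map_no_1001: "x \<in> no_1001 \<Longrightarrow> golden_map x \<in> no_1001"
proof -
  assume x: "x \<in> no_1001"
  have "map (digit (golden_map x)) [i..<i + 4] \<noteq> [1, 0, 0, 1]" for i
  proof -
    have "map (digit x) [i + 1..<(i + 4) + 1] = map (digit ((golden_map ^^ 1) x)) [i..<i + 4]"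
      by (rule map_digit_shift)
    moreover have "(i + 4) + 1 = (i + 1) + 4" by simp
    moreover have "map (digit x) [i + 1..<(i + 1) + 4] \<noteq> [1, 0, 0, 1]"
      using x unfolding no_1001_def mem_Collect_eq by (elim conjE) (rule spec)
    ultimately show ?thesis by simp
  qed
  then show ?thesis using golden_map_bounds by (simp add: no_1001_def)
qed

text \<open>Let \<open>a\<close> and \<open>b\<close> be the measures of the parts of the set below and above \<open>1 / golden\<close>.
  Forward invariance gives \<open>a \<le> (a + b) / golden\<close>, i.e. \<open>a \<le> golden * b\<close>. In the upper part the
  digits start with \<open>10\<close>, followed by either a 1, or a 0 which is not followed by a 1; hence
  \<open>b \<le> b / golden^2 + a / golden^3\<close>. Together \<open>b \<le> (2 / golden^2) b\<close>, and
  \<open>2 / golden^2 < 1\<close>.\<close>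

lemma emeasure_no_1001: "emeasure lborel no_1001 = 0"
proof -
  define L where "L = no_1001 \<inter> {..<1 / golden}"
  define H where "H = no_1001 \<inter> {1 / golden..}"
  have meas[measurable]: "L \<in> sets borel" "H \<in> sets borel" unfolding L_def H_def by measurable
  have N: "no_1001 = L \<union> H" "L \<inter> H = {}" by (auto simp: L_def H_def)
  \<comment> \<open>Finiteness allows the passage to real numbers, where terms can be moved across
    the inequalities.\<close>
  have fin: "emeasure lborel B \<noteq> \<infinity>" if "B \<subseteq> {0..<1}" for B :: "real set"
    using emeasure_mono[OF that, of lborel] by (auto simp: top_unique)
  have finL: "emeasure lborel L \<noteq> \<infinity>" and finH: "emeasure lborel H \<noteq> \<infinity>"
    by (rule fin; force simp: L_def H_def no_1001_def)+
  define a where "a = measure lborel L"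
  define b where "b = measure lborel H"
  have ab: "emeasure lborel L = ennreal a" "emeasure lborel H = ennreal b" "0 \<le> a" "0 \<le> b"
    using finL finH by (auto simp: a_def b_def emeasure_eq_ennreal_measure)
  have "L \<subseteq> {x. 0 + golden * x \<in> no_1001}"
  proof
    fix x assume "x \<in> L"
    then show "x \<in> {x. 0 + golden * x \<in> no_1001}"
      using golden_map_no_1001[of x] golden_map_low(1)[of x] by (auto simp: L_def no_1001_def)
  qed
  then have "emeasure lborel L \<le> emeasure lborel {x. 0 + golden * x \<in> no_1001}"
    by (intro emeasure_mono) measurable
  also have "\<dots> = ennreal (1 / golden) * (emeasure lborel L + emeasure lborel H)"
    using N by (simp add: emeasure_affine_vimage[where t=0, simplified] golden_pos plus_emeasure)
  finally have "ennreal a \<le> ennreal ((1 / golden) * (a + b))"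
    using ab golden_pos by (subst ennreal_mult) (auto simp: ennreal_plus)
  then have ineq_a: "a \<le> (1 / golden) * (a + b)"
    using ab golden_pos by (subst (asm) ennreal_le_iff) auto
  \<comment> \<open>The two affine maps are the second iterate on the cylinder of \<open>10\<close>
    and the third iterate on that of \<open>100\<close>.\<close>
  have "H \<subseteq> {x. - golden + (golden * golden) * x \<in> H} \<union> {x. - (golden * golden) + (golden * golden * golden) * x \<in> L}"
  proof
    fix x assume x: "x \<in> H"
    then have x1: "1 / golden \<le> x" "x < 1" and xN: "x \<in> no_1001" by (auto simp: H_def no_1001_def)
    let ?y = "golden_map (golden_map x)"
    have y: "?y = - golden + (golden * golden) * x"
    proof -
      have "?y = golden * golden_map x"
        using golden_map_high(3)[OF x1] golden_map_bounds[of x] by (intro golden_map_low) auto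
      then show ?thesis by (simp add: golden_map_high(1)[OF x1] algebra_simps)
    qed
    have yN: "?y \<in> no_1001" by (intro golden_map_no_1001 xN)
    show "x \<in> {x. - golden + (golden * golden) * x \<in> H} \<union> {x. - (golden * golden) + (golden * golden * golden) * x \<in> L}"
    proof (cases "?y \<in> H")
      case True
      then show ?thesis using y by simp
    next
      case False
      then have y1: "?y < 1 / golden" "0 \<le> ?y" using yN golden_map_bounds by (auto simp: H_def)
      let ?z = "golden_map ?y"
      have z: "?z = golden * ?y" "digit ?y 0 = 0" using golden_map_low y1 by auto
      have zN: "?z \<in> no_1001" by (intro golden_map_no_1001 yN)
      have "digit ?z 0 \<noteq> 1"
      proof
        assume "digit ?z 0 = 1"
        moreover have "digit x 0 = 1" using golden_map_high x1 by auto
        moreover have "digit (golden_map x) 0 = 0"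
          using golden_map_high(3)[OF x1] golden_map_bounds[of x] by (intro golden_map_low) auto
        ultimately have "map (digit x) [0..<0 + 4] = [1, 0, 0, 1]"
          using z by (simp add: upt_rec digit_Suc numeral_eq_Suc)
        then show False
          using xN unfolding no_1001_def mem_Collect_eq by (elim conjE) (drule spec, erule notE)
      qed
      then have "?z \<in> L" using zN digit_0_eq_1_iff[of ?z] by (auto simp: L_def no_1001_def)
      moreover have "?z = - (golden * golden) + (golden * golden * golden) * x"
        by (subst z(1), subst y, simp add: algebra_simps)
      ultimately show ?thesis by simp
    qed
  qed
  then have "emeasure lborel H \<le> emeasure lborel {x. - golden + (golden * golden) * x \<in> H}
      + emeasure lborel {x. - (golden * golden) + (golden * golden * golden) * x \<in> L}"
    by (intro order_trans[OF emeasure_mono emeasure_subadditive]) measurable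
  also have "\<dots> = ennreal (1 / (golden * golden)) * emeasure lborel H
      + ennreal (1 / (golden * golden * golden)) * emeasure lborel L"
    by (intro arg_cong2[where f="(+)"] emeasure_affine_vimage) (simp_all add: golden_pos)
  also have "\<dots> = ennreal (1 / (golden * golden) * b + 1 / (golden * golden * golden) * a)"
    unfolding ab using ab(3,4) golden_pos
    by (subst ennreal_plus, simp, simp, subst (1 2) ennreal_mult) simp_all
  finally have "ennreal b \<le> ennreal (1 / (golden * golden) * b + 1 / (golden * golden * golden) * a)"
    unfolding ab .
  then have ineq_b: "b \<le> 1 / (golden * golden) * b + 1 / (golden * golden * golden) * a"
    using ab golden_pos by (subst (asm) ennreal_le_iff) auto
  have "golden * a \<le> a + b"
    using ineq_a golden_pos by (simp add: field_simps)
  \<comment> \<open>By \<open>golden_square\<close> the left side becomes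
    \<open>golden * a + a\<close>, and \<open>golden * a\<close> cancels.\<close>
  then have "golden * (golden * a) \<le> golden * (a + b)" using golden_pos by simp
  then have a: "a \<le> golden * b"
    by (simp only: mult.assoc[symmetric] golden_square) (simp add: algebra_simps)
  have "(golden * golden * golden) * b \<le> (golden * golden * golden) * (1 / (golden * golden) * b + 1 / (golden * golden * golden) * a)"
    using ineq_b golden_pos by simp
  also have "\<dots> = golden * b + a" using golden_pos by (simp add: field_simps)
  also have "\<dots> \<le> golden * (2 * b)" using a by simp
  finally have "(golden * golden) * b \<le> 2 * b" using golden_pos by (simp add: mult.assoc)
  then have "(golden - 1) * b \<le> 0" by (simp only: golden_square) (simp add: algebra_simps)
  then have "b = 0" using ab golden_gt_1 by (simp add: mult_le_0_iff)
  then have "a = 0" using a ab by simp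
  have "emeasure lborel (L \<union> H) = emeasure lborel L + emeasure lborel H"
    using N by (intro plus_emeasure[symmetric]) auto
  then show ?thesis using N ab \<open>a = 0\<close> \<open>b = 0\<close> by simp
qed

lemma regular_measurable [measurable]: "Measurable.pred borel regular"
  unfolding regular_def infinite_nat_iff_unbounded_le mem_Collect_eq by measurable

text \<open>If every even gap of \<open>x\<close> starts before position \<open>n\<close>, then the
  \<open>n\<close>-th iterate of \<open>x\<close> avoids \<open>1001\<close>. So countably many null
  preimages cover the exceptional set.\<close>

lemma emeasure_not_regular: "emeasure lborel {x \<in> {1 / golden..<1}. \<not> regular x} = 0"
proof -
  let ?U = "\<Union>n. {x \<in> {0..<1}. (golden_map ^^ n) x \<in> no_1001}"
  have "{x \<in> {1 / golden..<1}. \<not> regular x} \<subseteq> ?U"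
  proof
    fix x assume x: "x \<in> {x \<in> {1 / golden..<1}. \<not> regular x}"
    then have "\<not> (\<forall>n. \<exists>i\<ge>n. \<exists>l\<ge>1. map (digit x) [i..<i + (2 * l + 2)] = even_gap l)"
      by (simp only: regular_def infinite_nat_iff_unbounded_le mem_Collect_eq) auto
    then obtain n where n: "\<And>i l. i \<ge> n \<Longrightarrow> l \<ge> 1 \<Longrightarrow> map (digit x) [i..<i + (2 * l + 2)] \<noteq> even_gap l"
      by blast
    have x0: "x \<in> {0..<1}" using x one_div_golden_le_imp_nonneg by auto
    have "map (digit ((golden_map ^^ n) x)) [i..<i + 4] \<noteq> [1, 0, 0, 1]" for i
    proof
      assume "map (digit ((golden_map ^^ n) x)) [i..<i + 4] = [1, 0, 0, 1]"
      then have "map (digit x) [i + n..<i + 4 + n] = even_gap 1"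
        by (simp only: map_digit_shift) (simp add: even_gap_def numeral_eq_Suc)
      moreover have "i + 4 + n = (i + n) + (2 * 1 + 2)" by simp
      ultimately show False using n[of "i + n" 1] by (metis le_add2 order_refl)
    qed
    then show "x \<in> ?U" using x0 funpow_golden_map_bounds[OF x0] by (auto simp: no_1001_def)
  qed
  moreover have "?U \<in> null_sets lborel"
    by (intro null_sets_UN null_setsI emeasure_golden_map_vimage_null emeasure_no_1001)
       (auto simp: no_1001_def)
  moreover have "{x \<in> {1 / golden..<1}. \<not> regular x} \<in> sets lborel" by measurable
  ultimately show ?thesis using null_sets_subset by blast
qed

section \<open>The splitting into blocks\<close>

lemma upt_split: "i \<le> j \<Longrightarrow> j \<le> k \<Longrightarrow> [i..<k] = [i..<j] @ [j..<k]"
  using upt_add_eq_append[of i j "k - j"] by simp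

text \<open>Turns the absence of a factor into a statement about positions, so that minimality of a
  position can be used.\<close>

lemma sublist_map_upt_iff:
  "sublist v (map e [0..<n]) \<longleftrightarrow> (\<exists>i. i + length v \<le> n \<and> map e [i..<i + length v] = v)"
proof
  assume "sublist v (map e [0..<n])"
  then obtain ps ss where eq: "map e [0..<n] = ps @ v @ ss" by (auto simp: sublist_def)
  have len: "n = length ps + length v + length ss" using arg_cong[OF eq, of length] by simp
  have "v = take (length v) (drop (length ps) (map e [0..<n]))" by (simp add: eq)
  also have "\<dots> = map e [length ps..<length ps + length v]"
    using len by (simp add: take_map drop_map)
  finally show "\<exists>i. i + length v \<le> n \<and> map e [i..<i + length v] = v"
    using len by (intro exI[of _ "length ps"]) simp
next
  assume "\<exists>i. i + length v \<le> n \<and> map e [i..<i + length v] = v"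
  then obtain i where i: "i + length v \<le> n" "map e [i..<i + length v] = v" by blast
  have "[0..<n] = [0..<i] @ [i..<i + length v] @ [i + length v..<n]"
    using i(1) by (simp flip: upt_split)
  then show "sublist v (map e [0..<n])" using i(2) by (metis map_append sublist_appendI)
qed

lemma map_upt_eq_append_iff:
  "map e [0..<length (u @ w)] = u @ w \<longleftrightarrow>
    map e [0..<length u] = u \<and> map (\<lambda>k. e (length u + k)) [0..<length w] = w"
proof -
  have "map e [0..<length (u @ w)] = map e [0..<length u] @ map (\<lambda>k. e (length u + k)) [0..<length w]"
    by (rule nth_equalityI) (auto simp: nth_append)
  then show ?thesis by (simp add: append_eq_append_conv)
qed

lemma length_even_gap: "length (even_gap l) = 2 * l + 2"
  by (simp add: even_gap_def)

section \<open>Blocks as prefixes of digit sequences\<close>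

lemma blocksD:
  assumes "b \<in> blocks"
  shows "set b \<subseteq> {0, 1}" "\<not> sublist [1, 1] b" "b \<noteq> []" "hd b = 1" "last b = 0"
  using assms by (auto simp: blocks_def)

lemma block_tail: "b \<in> blocks \<Longrightarrow> \<exists>u l. l \<ge> 1 \<and> b = u @ [1] @ replicate (2 * l) 0"
  unfolding blocks_def mem_Collect_eq by (elim conjE)

lemma block_no_even_gap: "b \<in> blocks \<Longrightarrow> l \<ge> 1 \<Longrightarrow> \<not> sublist (even_gap l) b"
  by (simp add: blocks_def)

text \<open>Cut just before the earliest closing 1 of an even gap. The prefix then ends in an even
  run of zeros, and an even gap inside it would have closed earlier.\<close>

lemma ex_first_block:
  assumes e: "\<And>k. e k \<in> {0, 1}" "\<And>k. e k = 1 \<Longrightarrow> e (Suc k) = 0" "e 0 = 1"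
    and gap: "l \<ge> 1" "map e [i..<i + (2 * l + 2)] = even_gap l"
  shows "\<exists>b\<in>blocks. map e [0..<length b] = b \<and> e (length b) = 1"
proof -
  \<comment> \<open>\<open>P j\<close> says that position \<open>j\<close> carries the closing 1 of
    an even gap.\<close>
  define P where "P j \<longleftrightarrow> (\<exists>i l. l \<ge> 1 \<and> j = i + (2 * l + 1) \<and> map e [i..<i + (2 * l + 2)] = even_gap l)" for j
  have "P (i + (2 * l + 1))" using gap unfolding P_def by blast
  then obtain j where j: "P j" and min: "\<And>k. P k \<Longrightarrow> j \<le> k"
    using LeastI[of P] Least_le[of P] by metis
  obtain i l where il: "l \<ge> 1" "j = i + (2 * l + 1)" "map e [i..<i + (2 * l + 2)] = even_gap l"
    using j unfolding P_def by blast
  have "map e [i..<j] @ [e j] = ([1] @ replicate (2 * l) 0) @ [1]"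
    using il(3) by (simp add: il(2) even_gap_def)
  then have tail: "map e [i..<j] = [1] @ replicate (2 * l) 0" and ej: "e j = 1"
    by (simp_all only: append1_eq_conv)
  define b where "b = map e [0..<j]"
  have "[0..<j] = [0..<i] @ [i..<j]"
    using il(2) by (intro upt_split) auto
  then have b: "b = map e [0..<i] @ [1] @ replicate (2 * l) 0"
    unfolding b_def using tail by (metis map_append)
  have "\<not> sublist [1, 1] b"
  proof
    assume "sublist [1, 1] b"
    then obtain k where "map e [k..<k + length [1, 1::int]] = [1, 1]"
      unfolding b_def sublist_map_upt_iff by (elim exE conjE) (rule that)
    then have "e k = 1 \<and> e (Suc k) = 1" by (simp add: upt_rec)
    then show False using e(2)[of k] by simp
  qed
  moreover have "\<not> sublist (even_gap m) b" if "m \<ge> 1" for m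
  proof
    assume "sublist (even_gap m) b"
    then obtain k where "k + (2 * m + 2) \<le> j" "map e [k..<k + (2 * m + 2)] = even_gap m"
      unfolding b_def sublist_map_upt_iff length_even_gap by blast
    then show False using min[of "k + (2 * m + 1)"] that unfolding P_def by fastforce
  qed
  moreover have "set b \<subseteq> {0, 1}" using e(1) by (auto simp: b_def)
  moreover have "b \<noteq> []" "hd b = 1" using il(2) e(3) by (simp_all add: b_def hd_conv_nth del: upt_Suc)
  moreover have "\<exists>u l. l \<ge> 1 \<and> b = u @ [1] @ replicate (2 * l) 0"
    using b il(1) by (intro exI conjI)
  ultimately have "b \<in> blocks" unfolding blocks_def by simp
  then show ?thesis using ej by (intro bexI[of _ b]) (simp_all add: b_def)
qed

text \<open>A block followed by a 1 ends with an even gap, which no longer block may contain.\<close>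

lemma block_length_le:
  assumes b: "b \<in> blocks" "map e [0..<length b] = b" "e (length b) = 1"
    and b': "b' \<in> blocks" "map e [0..<length b'] = b'"
  shows "length b' \<le> length b"
proof (rule ccontr)
  assume "\<not> length b' \<le> length b"
  then have "0 + Suc (length b) \<le> length b'" by simp
  then have "take (Suc (length b)) b' = map e [0..<Suc (length b)]"
    using arg_cong[OF b'(2), of "take (Suc (length b))"] by (simp only: take_map take_upt add_0)
  then have pre: "take (Suc (length b)) b' = b @ [1]"
    by (simp only: upt_Suc_append[OF le0] map_append list.map b(2,3))
  obtain u l where l: "l \<ge> 1" "b = u @ [1] @ replicate (2 * l) 0"
    using block_tail[OF b(1)] by (elim exE conjE) (rule that)
  have "sublist (even_gap l) (b @ [1])" unfolding l(2) by (simp add: even_gap_def)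
  then have "sublist (even_gap l) b'"
    unfolding pre[symmetric] by (rule sublist_order.order.trans) (rule sublist_take)
  then show False using block_no_even_gap b'(1) l(1) by blast
qed

section \<open>Uniqueness of the splitting\<close>

lemma splits_into_0:
  assumes "splits_into e B"
  shows "B 0 \<in> blocks" "map e [0..<length (B 0)] = B 0" "e 0 = 1"
proof -
  show *: "B 0 \<in> blocks" using assms by (simp add: splits_into_def)
  have "let w = concat (map B [0..<1]) in map e [0..<length w] = w"
    using assms unfolding splits_into_def by blast
  then show "map e [0..<length (B 0)] = B 0" by (simp add: Let_def)
  then show "e 0 = 1" using blocksD(3,4)[OF *]
    by (simp add: hd_conv_nth) (metis add_0 length_greater_0_conv nth_map_upt minus_nat.diff_0)
qed

lemma splits_into_shift:
  assumes "splits_into e B"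
  shows "splits_into (\<lambda>k. e (length (B 0) + k)) (\<lambda>n. B (Suc n))"
  unfolding splits_into_def
proof safe
  fix n show "B (Suc n) \<in> blocks" using assms by (simp add: splits_into_def)
  have "let w = concat (map B [0..<Suc n]) in map e [0..<length w] = w"
    using assms unfolding splits_into_def by blast
  moreover have "concat (map B [0..<Suc n]) = B 0 @ concat (map (\<lambda>n. B (Suc n)) [0..<n])"
    by (simp add: map_upt_Suc del: upt_Suc)
  ultimately show "let w = concat (map (\<lambda>n. B (Suc n)) [0..<n]) in
      map (\<lambda>k. e (length (B 0) + k)) [0..<length w] = w"
    unfolding Let_def by (simp only: map_upt_eq_append_iff)
qed

text \<open>The second block starts with 1. This supplies the hypothesis on the following digit in
  \<open>block_length_le\<close>.\<close>

lemma splits_into_next: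
  assumes "splits_into e B" shows "e (length (B 0)) = 1"
  using splits_into_0(3)[OF splits_into_shift[OF assms]] by simp

lemma splits_into_length_le:
  assumes "splits_into e B" "splits_into e B'" shows "length (B' 0) \<le> length (B 0)"
  by (rule block_length_le[OF splits_into_0(1,2)[OF assms(1)] splits_into_next[OF assms(1)]
        splits_into_0(1,2)[OF assms(2)]])

text \<open>The two first blocks are prefixes of \<open>e\<close> of equal length, hence equal;
  removing them leaves two splittings of the same tail, so the induction lets \<open>e\<close>
  vary.\<close>

lemma splits_into_unique:
  assumes "splits_into e B" "splits_into e B'" shows "B n = B' n"
  using assms
proof (induction n arbitrary: e B B')
  case 0
  have "length (B 0) = length (B' 0)"
    by (rule antisym[OF splits_into_length_le[OF 0(2,1)] splits_into_length_le[OF 0]])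
  then show ?case using splits_into_0(2)[OF 0(1)] splits_into_0(2)[OF 0(2)] by metis
next
  case (Suc n)
  have "length (B 0) = length (B' 0)"
    by (rule antisym[OF splits_into_length_le[OF Suc.prems(2,1)] splits_into_length_le[OF Suc.prems]])
  then show ?case
    by (intro Suc.IH[OF splits_into_shift[OF Suc.prems(1)]]) (simp only: splits_into_shift[OF Suc.prems(2)])
qed

section \<open>The first block, the goldenshift and the block expansion\<close>

definition first_block :: "real \<Rightarrow> int list" where
  "first_block x = (THE b. b \<in> blocks \<and> map (digit x) [0..<length b] = b \<and> digit x (length b) = 1)"

definition goldenshift :: "real \<Rightarrow> real" where
  "goldenshift x = (golden_map ^^ length (first_block x)) x"

text \<open>Uniqueness rests on the digit 1 after the block: without it both \<open>100\<close> and
  \<open>10000\<close> would qualify for an expansion beginning with \<open>10000\<close>.\<close>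

lemma first_block_eqI:
  assumes "b \<in> blocks" "map (digit x) [0..<length b] = b" "digit x (length b) = 1"
  shows "first_block x = b"
  unfolding first_block_def
proof (rule the_equality)
  fix b' assume b': "b' \<in> blocks \<and> map (digit x) [0..<length b'] = b' \<and> digit x (length b') = 1"
  then have "length b' = length b"
    using assms by (intro antisym block_length_le[where e = "digit x"]) auto
  then show "b' = b" using b' assms by metis
qed (use assms in auto)

lemma regularD:
  assumes "regular x" shows "x \<in> {0..<1}" "digit x 0 = 1"
proof -
  show "x \<in> {0..<1}" using assms one_div_golden_le_imp_nonneg by (auto simp: regular_def)
  then show "digit x 0 = 1" using assms by (simp add: digit_0_eq_1_iff regular_def)
qed

lemma regular_first_block:
  assumes "regular x"
  shows "first_block x \<in> blocks" "map (digit x) [0..<length (first_block x)] = first_block x"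
    "digit x (length (first_block x)) = 1"
proof -
  have "{i. \<exists>l\<ge>1. map (digit x) [i..<i + (2 * l + 2)] = even_gap l} \<noteq> {}"
    using assms infinite_imp_nonempty unfolding regular_def by blast
  then obtain i l where "l \<ge> 1" "map (digit x) [i..<i + (2 * l + 2)] = even_gap l" by blast
  then have "\<exists>b\<in>blocks. map (digit x) [0..<length b] = b \<and> digit x (length b) = 1"
    by (intro ex_first_block digit_in digit_no_adjacent_ones regularD[OF assms])
  then show "first_block x \<in> blocks" "map (digit x) [0..<length (first_block x)] = first_block x"
    "digit x (length (first_block x)) = 1"
    using first_block_eqI by metis+
qed

lemma frequently_shift_iff: "(\<forall>n. \<exists>i\<ge>n. P (i + k)) \<longleftrightarrow> (\<forall>n. \<exists>i\<ge>n. P i)" for k :: nat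
proof safe
  fix n assume "\<forall>n. \<exists>i\<ge>n. P (i + k)"
  then obtain i where "i \<ge> n" "P (i + k)" by blast
  then show "\<exists>i\<ge>n. P i" by (intro exI[of _ "i + k"] conjI) simp_all
next
  fix n assume "\<forall>n. \<exists>i\<ge>n. P i"
  then obtain i where "i \<ge> n + k" "P i" by blast
  then show "\<exists>i\<ge>n. P (i + k)" by (intro exI[of _ "i - k"] conjI) simp_all
qed

text \<open>Apart from the leading 1, regularity is a property of the tail. One direction keeps the
  goldenshift inside the regular points; the other passes regularity from an image back to the
  points of a cylinder.\<close>

lemma regular_funpow_iff:
  assumes x: "x \<in> {0..<1}" "digit x 0 = 1" "digit x k = 1"
  shows "regular ((golden_map ^^ k) x) \<longleftrightarrow> regular x"
proof -
  let ?y = "(golden_map ^^ k) x"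
  let ?Q = "\<lambda>x i. \<exists>l\<ge>1. map (digit x) [i..<i + (2 * l + 2)] = even_gap l"
  have y: "?y \<in> {0..<1}" "digit ?y 0 = 1"
    using funpow_golden_map_bounds x by (auto simp: digit_funpow)
  have "map (digit ?y) [i..<i + m] = map (digit x) [i + k..<(i + k) + m]" for i m
    using map_digit_shift[of x i k "i + m"] by (simp add: ac_simps)
  then have Q: "?Q ?y i \<longleftrightarrow> ?Q x (i + k)" for i by (simp only:)
  have "(\<forall>n. \<exists>i\<ge>n. ?Q ?y i) \<longleftrightarrow> (\<forall>n. \<exists>i\<ge>n. ?Q x i)"
    unfolding Q by (rule frequently_shift_iff)
  then show ?thesis
    using x y digit_0_eq_1_iff
    unfolding regular_def infinite_nat_iff_unbounded_le mem_Collect_eq by auto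
qed

lemma regular_goldenshift: "regular x \<Longrightarrow> regular (goldenshift x)"
  unfolding goldenshift_def by (rule regular_funpow_iff[THEN iffD2, OF regularD regular_first_block(3)])

lemma regular_funpow_goldenshift: "regular x \<Longrightarrow> regular ((goldenshift ^^ n) x)"
  by (induction n) (simp_all add: regular_goldenshift)

lemma splits_into_first_block:
  assumes "regular x" shows "splits_into (digit x) (\<lambda>n. first_block ((goldenshift ^^ n) x))"
  unfolding splits_into_def
proof safe
  fix n show "first_block ((goldenshift ^^ n) x) \<in> blocks"
    by (intro regular_first_block regular_funpow_goldenshift assms)
  let ?w = "\<lambda>x n. concat (map (\<lambda>n. first_block ((goldenshift ^^ n) x)) [0..<n])"
  have "map (digit x) [0..<length (?w x n)] = ?w x n"
    using assms
  proof (induction n arbitrary: x)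
    case (Suc n)
    have w: "?w x (Suc n) = first_block x @ ?w (goldenshift x) n"
      by (simp add: map_upt_Suc funpow_swap1 del: upt_Suc)
    have "(\<lambda>k. digit x (length (first_block x) + k)) = digit (goldenshift x)"
      by (simp add: goldenshift_def digit_funpow fun_eq_iff)
    then show ?case
      using Suc.IH[OF regular_goldenshift[OF Suc.prems]] regular_first_block(2)[OF Suc.prems]
      unfolding w map_upt_eq_append_iff by simp
  qed simp
  then show "let w = ?w x n in map (digit x) [0..<length w] = w" by simp
qed

text \<open>Existence and uniqueness of the splitting evaluate the description operator; the blocks
  become one function observed along the goldenshift orbit.\<close>

lemma block_expansion_eq:
  assumes "regular x" shows "block_expansion x n = first_block ((goldenshift ^^ n) x)"
proof -
  have "block_expansion x = (\<lambda>n. first_block ((goldenshift ^^ n) x))"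
    unfolding block_expansion_def
    using splits_into_first_block[OF assms] splits_into_unique by (intro the_equality ext) blast+
  then show ?thesis by simp
qed

text \<open>Points of \<open>A\<close> start with digit 1, so each point of the cylinder has a 1
  right after \<open>b\<close>. This makes \<open>b\<close> its first block and the point itself
  regular. The set \<open>A\<close> is otherwise arbitrary, so \<open>b\<close> puts no constraint
  on what follows.\<close>

lemma cylinder_block:
  assumes b: "b \<in> blocks" and A: "A \<subseteq> {x. regular x}"
  shows "{x. regular x \<and> first_block x = b \<and> goldenshift x \<in> A} = cylinder b A"
proof safe
  fix x assume "regular x" "goldenshift x \<in> A" "b = first_block x"
  then show "x \<in> cylinder (first_block x) A"
    using regular_first_block(2) regularD(1) by (auto simp: cylinder_def goldenshift_def)
next
  fix x assume "x \<in> cylinder b A"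
  then have x: "x \<in> {0..<1}" "map (digit x) [0..<length b] = b" "(golden_map ^^ length b) x \<in> A"
    by (auto simp: cylinder_def)
  then have reg: "regular ((golden_map ^^ length b) x)" using A by auto
  then have 1: "digit x (length b) = 1" using regularD(2)[of "(golden_map ^^ length b) x"]
    by (simp add: digit_funpow)
  have "digit x 0 = hd (map (digit x) [0..<length b])"
    using blocksD(3)[OF b] by (simp add: hd_map)
  then have "digit x 0 = 1" using x(2) blocksD(4)[OF b] by simp
  then show "regular x" using reg regular_funpow_iff x(1) 1 by blast
  show fb: "first_block x = b" using b x(2) 1 by (rule first_block_eqI)
  show "goldenshift x \<in> A" using x(3) by (simp add: goldenshift_def fb)
qed

section \<open>The law of the blocks\<close>

lemma one_div_golden_less_1: "1 / golden < 1"
  using golden_gt_1 by simp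

lemma space_leb_regular: "space leb_regular = {x. regular x}"
  by (simp add: leb_regular_def leb_def space_restrict_space)

lemma sets_leb_regular_iff: "A \<in> sets leb_regular \<longleftrightarrow> A \<in> sets borel \<and> A \<subseteq> {x. regular x}"
proof -
  have "{x. regular x} \<in> sets borel" by measurable
  then show ?thesis
    unfolding leb_regular_def by (subst sets_restrict_space_iff) (auto simp: leb_def)
qed

lemma emeasure_leb_regular:
  assumes "A \<in> sets borel" "A \<subseteq> {x. regular x}"
  shows "emeasure leb_regular A = emeasure lborel A / ennreal (1 - 1 / golden)"
proof -
  have [measurable]: "{x. regular x} \<in> sets borel" by measurable
  have "emeasure leb_regular A = emeasure leb A"
    unfolding leb_regular_def using assms by (intro emeasure_restrict_space) (auto simp: leb_def)
  also have "\<dots> = emeasure lborel ({1 / golden<..<1} \<inter> A) / emeasure lborel {1 / golden<..<1}"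
    unfolding leb_def using assms by (intro emeasure_uniform_measure) auto
  \<comment> \<open>\<open>regular\<close> admits the left end point, which the open interval
    excludes; a single point is null.\<close>
  also have "emeasure lborel ({1 / golden<..<1} \<inter> A) = emeasure lborel A"
  proof (rule emeasure_eq_AE)
    have "A \<subseteq> {1 / golden..<1}" using assms(2) unfolding regular_def by auto
    then have "x \<noteq> 1 / golden \<Longrightarrow> x \<in> {1 / golden<..<1} \<inter> A \<longleftrightarrow> x \<in> A" for x by auto
    then show "AE x in lborel. x \<in> {1 / golden<..<1} \<inter> A \<longleftrightarrow> x \<in> A"
      by (rule eventually_mono[OF AE_lborel_singleton])
  qed (use assms in auto)
  also have "emeasure lborel {1 / golden<..<1} = ennreal (1 - 1 / golden)"
    using one_div_golden_less_1 by simp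
  finally show ?thesis .
qed

lemma prob_space_leb_regular: "prob_space leb_regular"
proof (rule prob_spaceI)
  let ?R = "{x. regular x}" and ?N = "{x \<in> {1 / golden..<1}. \<not> regular x}"
  have "emeasure lborel ({1 / golden..<1} - ?N) = emeasure lborel {1 / golden..<1}"
    using emeasure_not_regular by (intro emeasure_Diff_null_set null_setsI) auto
  moreover have "{1 / golden..<1} - ?N = ?R" by (auto simp: regular_def)
  ultimately have "emeasure lborel ?R = ennreal (1 - 1 / golden)"
    using one_div_golden_less_1 by simp
  moreover have "?R \<in> sets borel" by measurable
  ultimately show "emeasure leb_regular (space leb_regular) = 1"
    using golden_gt_1 by (simp add: space_leb_regular emeasure_leb_regular divide_ennreal)
qed

interpretation leb_regular: prob_space leb_regular
  by (rule prob_space_leb_regular)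

section \<open>Measurability, independence of the first block and the product formula\<close>

lemma first_block_measurable: "first_block \<in> leb_regular \<rightarrow>\<^sub>M count_space blocks"
  unfolding measurable_count_space_eq2_countable
proof safe
  fix x assume "x \<in> space leb_regular"
  then show "first_block x \<in> blocks" by (simp add: space_leb_regular regular_first_block)
next
  fix b assume b: "b \<in> blocks"
  \<comment> \<open>The condition on \<open>goldenshift x\<close> holds automatically and brings the
    set into the form of \<open>cylinder_block\<close>.\<close>
  have "first_block -` {b} \<inter> space leb_regular
      = {x. regular x \<and> first_block x = b \<and> goldenshift x \<in> {x. regular x}}"
    by (auto simp: space_leb_regular regular_goldenshift)
  also have "\<dots> = cylinder b {x. regular x}" using b by (rule cylinder_block) simp
  also have "\<dots> \<in> sets borel" by measurable
  finally show "first_block -` {b} \<inter> space leb_regular \<in> sets leb_regular"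
    by (auto simp: sets_leb_regular_iff space_leb_regular)
qed

lemma goldenshift_measurable: "goldenshift \<in> leb_regular \<rightarrow>\<^sub>M leb_regular"
proof (rule measurableI)
  show "x \<in> space leb_regular \<Longrightarrow> goldenshift x \<in> space leb_regular" for x
    by (simp add: space_leb_regular regular_goldenshift)
  fix A assume A: "A \<in> sets leb_regular"
  have "goldenshift -` A \<inter> space leb_regular = (\<Union>b\<in>blocks. {x. regular x \<and> first_block x = b \<and> goldenshift x \<in> A})"
    by (auto simp: space_leb_regular regular_first_block)
  also have "\<dots> = (\<Union>b\<in>blocks. cylinder b A)"
    using A by (intro SUP_cong cylinder_block) (auto simp: sets_leb_regular_iff)
  also have "\<dots> \<in> sets borel"
    using A by (intro sets.countable_UN' countableI_type cylinder_measurable) (auto simp: sets_leb_regular_iff)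
  finally show "goldenshift -` A \<inter> space leb_regular \<in> sets leb_regular"
    by (auto simp: sets_leb_regular_iff space_leb_regular)
qed

lemma funpow_goldenshift_measurable: "(goldenshift ^^ n) \<in> leb_regular \<rightarrow>\<^sub>M leb_regular"
  by (induction n) (auto simp only: funpow.simps intro: measurable_ident measurable_comp goldenshift_measurable)

text \<open>A possibly infinite sum, written as an integral over counting measure: the form in which
  \<open>emeasure_UN_countable\<close> delivers it, and with no summability to check.\<close>

definition weight :: "int list set \<Rightarrow> ennreal" where
  "weight F = (\<integral>\<^sup>+b. ennreal ((1 / golden) ^ length b) \<partial>count_space F)"

text \<open>Each cylinder over \<open>A\<close> is a fixed multiple of \<open>A\<close>, and the
  normalisation is the same on both sides, so the sum over \<open>b\<close> factors out.\<close>

lemma emeasure_block_goldenshift: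
  assumes F: "F \<subseteq> blocks" and A: "A \<in> sets leb_regular"
  shows "emeasure leb_regular {x. regular x \<and> first_block x \<in> F \<and> goldenshift x \<in> A}
    = weight F * emeasure leb_regular A"
proof -
  have A': "A \<in> sets borel" "A \<subseteq> {x. regular x}" using A by (auto simp: sets_leb_regular_iff)
  have cyl: "cylinder b A \<in> sets leb_regular" "emeasure leb_regular (cylinder b A)
      = ennreal ((1 / golden) ^ length b) * emeasure leb_regular A" if "b \<in> F" for b
  proof -
    have b: "b \<in> blocks" using that F by blast
    have reg: "cylinder b A \<subseteq> {x. regular x}" using cylinder_block[OF b A'(2)] by blast
    then show "cylinder b A \<in> sets leb_regular"
      using A' by (simp add: sets_leb_regular_iff)
    have "A \<subseteq> {0..<1}" using A' regularD(1) by blast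
    then show "emeasure leb_regular (cylinder b A)
        = ennreal ((1 / golden) ^ length b) * emeasure leb_regular A"
      using A' reg blocksD[OF b]
      by (simp add: emeasure_leb_regular emeasure_cylinder ennreal_times_divide)
  qed
  have "{x. regular x \<and> first_block x \<in> F \<and> goldenshift x \<in> A}
      = (\<Union>b\<in>F. {x. regular x \<and> first_block x = b \<and> goldenshift x \<in> A})"
    by blast
  also have "\<dots> = (\<Union>b\<in>F. cylinder b A)"
    using F A' by (intro SUP_cong cylinder_block) auto
  also have "emeasure leb_regular \<dots> = (\<integral>\<^sup>+b. emeasure leb_regular (cylinder b A) \<partial>count_space F)"
  proof (intro emeasure_UN_countable cyl countableI_type)
    \<comment> \<open>Distinct cylinders fix distinct values of \<open>first_block\<close>.\<close>
    show "disjoint_family_on (\<lambda>b. cylinder b A) F"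
      using F A' unfolding disjoint_family_on_def by (auto simp: cylinder_block[symmetric] subset_iff)
  qed
  also have "\<dots> = (\<integral>\<^sup>+b. ennreal ((1 / golden) ^ length b) * emeasure leb_regular A \<partial>count_space F)"
    by (intro nn_integral_cong) (simp add: cyl)
  also have "\<dots> = weight F * emeasure leb_regular A"
    unfolding weight_def by (intro nn_integral_multc) simp
  finally show ?thesis .
qed

text \<open>The constraints on the later blocks form an event about \<open>goldenshift x\<close>
  with the family shifted by one; hence \<open>F\<close> varies in the induction.\<close>

lemma emeasure_block_box:
  assumes "\<And>i. i < n \<Longrightarrow> F i \<subseteq> blocks"
  shows "emeasure leb_regular {x. regular x \<and> (\<forall>i<n. first_block ((goldenshift ^^ i) x) \<in> F i)}
    = (\<Prod>i<n. weight (F i))"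
  using assms
proof (induction n arbitrary: F)
  case 0
  then show ?case using leb_regular.emeasure_space_1 by (simp add: space_leb_regular)
next
  case (Suc n)
  let ?A = "{x. regular x \<and> (\<forall>i<n. first_block ((goldenshift ^^ i) x) \<in> F (Suc i))}"
  have "Measurable.pred leb_regular (\<lambda>x. first_block ((goldenshift ^^ i) x) \<in> F (Suc i))" if "i < n" for i
    using Suc.prems[of "Suc i"] that
    by (intro pred_sets2[OF _ measurable_compose[OF funpow_goldenshift_measurable first_block_measurable]]) auto
  then have "{x \<in> space leb_regular. \<forall>i<n. first_block ((goldenshift ^^ i) x) \<in> F (Suc i)} \<in> sets leb_regular"
    by measurable
  then have A: "?A \<in> sets leb_regular" by (simp add: space_leb_regular)
  have "{x. regular x \<and> (\<forall>i<Suc n. first_block ((goldenshift ^^ i) x) \<in> F i)}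
      = {x. regular x \<and> first_block x \<in> F 0 \<and> goldenshift x \<in> ?A}"
    by (auto simp: All_less_Suc2 funpow_swap1 regular_goldenshift)
  also have "emeasure leb_regular \<dots> = weight (F 0) * emeasure leb_regular ?A"
    using Suc.prems by (intro emeasure_block_goldenshift A) simp
  also have "emeasure leb_regular ?A = (\<Prod>i<n. weight (F (Suc i)))"
    using Suc.prems by (intro Suc.IH) simp
  finally show ?case by (simp only: prod.lessThan_Suc_shift)
qed

text \<open>A box of length one admitting all blocks is the whole space, so the sum of the weights
  is read off from total mass 1.\<close>

lemma weight_blocks: "weight blocks = 1"
proof -
  have "{x. regular x \<and> first_block x \<in> blocks} = space leb_regular"
    by (auto simp: space_leb_regular regular_first_block)
  then show ?thesis
    using emeasure_block_box[of 1 "\<lambda>_. blocks"] leb_regular.emeasure_space_1 by simp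
qed

section \<open>Joint and marginal laws of the block expansion\<close>

lemma block_expansion_component_measurable:
  "(\<lambda>x. block_expansion x n) \<in> leb_regular \<rightarrow>\<^sub>M count_space blocks"
proof -
  have "(\<lambda>x. first_block ((goldenshift ^^ n) x)) \<in> leb_regular \<rightarrow>\<^sub>M count_space blocks"
    using funpow_goldenshift_measurable first_block_measurable by (rule measurable_compose)
  then show ?thesis
    by (subst measurable_cong[where g = "\<lambda>x. first_block ((goldenshift ^^ n) x)"])
       (auto simp: space_leb_regular block_expansion_eq)
qed

lemma emeasure_block_expansion_box:
  assumes J: "finite J" and F: "\<And>j. j \<in> J \<Longrightarrow> F j \<subseteq> blocks"
  shows "emeasure leb_regular {x \<in> space leb_regular. \<forall>j\<in>J. block_expansion x j \<in> F j}
    = (\<Prod>j\<in>J. weight (F j))"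
proof -
  \<comment> \<open>Unconstrained coordinates receive all of \<open>blocks\<close>, whose weight is
    1, so the box over an initial segment has the same product.\<close>
  define G where "G j = (if j \<in> J then F j else blocks)" for j
  obtain n where n: "J \<subseteq> {..<n}" using finite_nat_iff_bounded[of J] J by blast
  have "{x \<in> space leb_regular. \<forall>j\<in>J. block_expansion x j \<in> F j}
      = {x. regular x \<and> (\<forall>i<n. first_block ((goldenshift ^^ i) x) \<in> G i)}"
    using n regular_first_block(1)[OF regular_funpow_goldenshift]
    by (auto simp: space_leb_regular block_expansion_eq G_def)
  also have "emeasure leb_regular \<dots> = (\<Prod>i<n. weight (G i))"
    using F by (intro emeasure_block_box) (auto simp: G_def)
  also have "\<dots> = (\<Prod>j\<in>J. weight (F j))"
    using n by (intro prod.mono_neutral_cong_right) (auto simp: G_def weight_blocks)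
  finally show ?thesis .
qed

definition block_law :: "int list measure" where
  "block_law = distr leb_regular (count_space blocks) (\<lambda>x. block_expansion x 0)"

text \<open>The value is free of \<open>n\<close>, which gives identical distribution; a single
  block \<open>b\<close> has mass \<open>golden^(-|b|)\<close>.\<close>

lemma emeasure_distr_block_expansion:
  assumes "F \<subseteq> blocks"
  shows "emeasure (distr leb_regular (count_space blocks) (\<lambda>x. block_expansion x n)) F = weight F"
proof -
  have "emeasure (distr leb_regular (count_space blocks) (\<lambda>x. block_expansion x n)) F
      = emeasure leb_regular {x \<in> space leb_regular. block_expansion x n \<in> F}"
    using assms by (subst emeasure_distr[OF block_expansion_component_measurable])
      (auto intro!: arg_cong[where f = "emeasure leb_regular"])
  then show ?thesis using emeasure_block_expansion_box[of "{n}" "\<lambda>_. F"] assms by simp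
qed

lemma distr_block_expansion:
  "distr leb_regular (count_space blocks) (\<lambda>x. block_expansion x n) = block_law"
  unfolding block_law_def
  by (rule measure_eqI) (auto simp: emeasure_distr_block_expansion)

lemma prob_space_block_law: "prob_space block_law"
  unfolding block_law_def
  by (intro leb_regular.prob_space_distr block_expansion_component_measurable)

lemma sets_block_law: "sets block_law = sets (count_space blocks)"
  by (simp add: block_law_def)

lemma block_expansion_measurable: "block_expansion \<in> leb_regular \<rightarrow>\<^sub>M block_space"
  unfolding block_space_def
  by (rule measurable_PiM_single') (auto intro: block_expansion_component_measurable
      measurable_space[OF block_expansion_component_measurable, simplified])

text \<open>Boxes constraining finitely many coordinates generate the product sigma-algebra and are
  closed under intersection, so it suffices that the two finite measures agree on them.\<close>

lemma block_measure_eq_PiM: "block_measure = (\<Pi>\<^sub>M n\<in>UNIV. block_law)"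
proof (rule measure_eqI_PiM_infinite)
  show sets: "sets block_measure = sets (\<Pi>\<^sub>M n\<in>UNIV. block_law)"
    unfolding block_measure_def block_space_def sets_distr by (intro sets_PiM_cong) (auto simp: sets_block_law)
  show "finite_measure block_measure"
    unfolding block_measure_def
    by (intro prob_space.finite_measure leb_regular.prob_space_distr block_expansion_measurable)
  fix F and J :: "nat set"
  assume J: "finite J" and "\<And>j. j \<in> J \<Longrightarrow> F j \<in> sets block_law"
  then have F: "\<And>j. j \<in> J \<Longrightarrow> F j \<subseteq> blocks" by (simp add: sets_block_law)
  let ?E = "prod_emb UNIV (\<lambda>n. block_law) J (Pi\<^sub>E J F)"
  have E: "?E \<in> sets block_space"
    using J F sets unfolding block_measure_def sets_distr
    by (simp only:) (intro sets_PiM_I, auto simp: sets_block_law)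
  have "block_expansion -` ?E \<inter> space leb_regular
      = {x \<in> space leb_regular. \<forall>j\<in>J. block_expansion x j \<in> F j}"
    using measurable_space[OF block_expansion_component_measurable]
    by (auto simp: prod_emb_def block_law_def PiE_iff extensional_def restrict_def space_PiM)
  then have "emeasure block_measure ?E = (\<Prod>j\<in>J. weight (F j))"
    unfolding block_measure_def emeasure_distr[OF block_expansion_measurable E]
    using emeasure_block_expansion_box[OF J F] by simp
  also have "\<dots> = (\<Prod>j\<in>J. emeasure block_law (F j))"
    using F by (intro prod.cong) (simp_all add: block_law_def emeasure_distr_block_expansion)
  also have "\<dots> = emeasure (\<Pi>\<^sub>M n\<in>UNIV. block_law) ?E"
    using J F by (intro emeasure_PiM_emb[symmetric] prob_space_block_law) (auto simp: sets_block_law)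
  finally show "emeasure block_measure ?E = emeasure (\<Pi>\<^sub>M n\<in>UNIV. block_law) ?E" .
qed simp

theorem theorem2p4:
  shows "prob_space leb_regular
    \<and> block_expansion \<in> leb_regular \<rightarrow>\<^sub>M block_space
    \<and> (\<exists>p :: int list measure. prob_space p \<and> sets p = sets (count_space blocks)
          \<and> block_measure = (\<Pi>\<^sub>M n\<in>(UNIV :: nat set). p))
    \<and> prob_space.indep_vars leb_regular (\<lambda>n. count_space blocks)
          (\<lambda>n x. block_expansion x n) (UNIV :: nat set)
    \<and> (\<forall>n. distr leb_regular (count_space blocks) (\<lambda>x. block_expansion x n)
          = distr leb_regular (count_space blocks) (\<lambda>x. block_expansion x 0))"
proof (intro conjI allI)
  show "prob_space leb_regular" by (rule prob_space_leb_regular)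
  show "block_expansion \<in> leb_regular \<rightarrow>\<^sub>M block_space" by (rule block_expansion_measurable)
  show "\<exists>p :: int list measure. prob_space p \<and> sets p = sets (count_space blocks)
      \<and> block_measure = (\<Pi>\<^sub>M n\<in>(UNIV :: nat set). p)"
    using prob_space_block_law sets_block_law block_measure_eq_PiM by blast
  have "(\<lambda>x. \<lambda>i\<in>UNIV. block_expansion x i) = block_expansion"
    by (simp add: restrict_def)
  \<comment> \<open>Independence means that the joint law is the product of the marginals. With the
    restriction to \<open>UNIV\<close> removed, the joint law is \<open>block_measure\<close>, and
    all marginals are \<open>block_law\<close>.\<close>
  then show "leb_regular.indep_vars (\<lambda>n. count_space blocks) (\<lambda>n x. block_expansion x n) (UNIV :: nat set)"
    by (subst leb_regular.indep_vars_iff_distr_eq_PiM)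
       (auto intro: block_expansion_component_measurable
          simp: distr_block_expansion block_measure_eq_PiM[unfolded block_measure_def block_space_def])
  show "distr leb_regular (count_space blocks) (\<lambda>x. block_expansion x n)
      = distr leb_regular (count_space blocks) (\<lambda>x. block_expansion x 0)" for n
    by (simp only: distr_block_expansion)
qed

end
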